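(* The following conditions on an abelian group $B$ are equivalent: (1) There exists a surjective homomorphism $f:\prod_{i\in I}A_i\to B$ from the direct product of a family of abelian groups (indexed by some set $I$) to $B$, which does not factor through the natural map from $\prod_{i\in I}A_i$ to the direct product of finitely many countably complete ultraproducts of the $A_i$. (2) There exists a surjective homomorphism $f:\prod_{n\in\omega}A_n\to B$ from the direct product of a countable family of abelian groups to $B$, which does not factor through the natural map of $\prod_{n\in\omega}A_n$ to the direct product of finitely many ultraproducts (principal or nonprincipal) of the $A_n$. (3) $B$ is not slender. These are also equivalent to the variants of conditions (1) and (2) without the assumption that $f$ be surjective.
   Context: An abelian group $B$ is called slender if it is torsion-free and every homomorphism $f:\mathbb Z^\omega\to B$ annihilates all but finitely many of the elements $\delta_n$ $(n\in\omega)$, where $\delta_n\in\mathbb Z^\omega$ has $1$ in the $n$-th position and $0$ in all other positions. An ultrafilter is countably complete if it is closed under countable intersections (principal ultrafilters are countably complete); a countably complete ultraproduct is an ultraproduct with respect to a countably complete ultrafilter. A homomorphism on $\prod_{i\in I}A_i$ factors through the natural map to the direct product of finitely many ultraproducts if, for some finite (possibly empty) family of ultrafilters $\mathcal U_0,\dots,\mathcal U_{m-1}$ on $I$ (of the indicated kind), it is the composite of the natural map $\prod_{i\in I}A_i\to\prod_{i\in I}A_i/\mathcal U_0\times\dots\times\prod_{i\in I}A_i/\mathcal U_{m-1}$ with a homomorphism defined on that product. *)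

theory Defs
  imports "HOL-Algebra.Algebra"
begin

definition ultrafilter_on :: "'i set \<Rightarrow> 'i set set \<Rightarrow> bool" where
  "ultrafilter_on I U \<longleftrightarrow>
     U \<subseteq> Pow I \<and> I \<in> U \<and> {} \<notin> U \<and>
     (\<forall>S\<in>U. \<forall>T\<in>U. S \<inter> T \<in> U) \<and>
     (\<forall>S\<in>U. \<forall>T. S \<subseteq> T \<and> T \<subseteq> I \<longrightarrow> T \<in> U) \<and>
     (\<forall>S. S \<subseteq> I \<longrightarrow> S \<in> U \<or> I - S \<in> U)"

definition countably_complete :: "'i set set \<Rightarrow> bool" where
  "countably_complete U \<longleftrightarrow> (\<forall>S :: nat \<Rightarrow> 'i set. (\<forall>n. S n \<in> U) \<longrightarrow> (\<Inter>n. S n) \<in> U)"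

text \<open>
  The ultraproduct identifies two families when they agree on a set belonging to \<open>U\<close>. For groups
  this is the quotient by the normal subgroup of families that are trivial on a set belonging
  to \<open>U\<close>; the lemma \<open>ultraproduct_map_eq_iff\<close> below recovers the description by agreement.
\<close>

definition ultraproduct_kernel ::
    "'i set \<Rightarrow> ('i \<Rightarrow> 'a monoid) \<Rightarrow> 'i set set \<Rightarrow> ('i \<Rightarrow> 'a) set" where
  "ultraproduct_kernel I A U =
     {x \<in> carrier (product_group I A). {i \<in> I. x i = \<one>\<^bsub>A i\<^esub>} \<in> U}"

definition ultraproduct ::
    "'i set \<Rightarrow> ('i \<Rightarrow> 'a monoid) \<Rightarrow> 'i set set \<Rightarrow> ('i \<Rightarrow> 'a) set monoid" where
  "ultraproduct I A U = product_group I A Mod ultraproduct_kernel I A U"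

definition ultraproduct_map ::
    "'i set \<Rightarrow> ('i \<Rightarrow> 'a monoid) \<Rightarrow> 'i set set \<Rightarrow> ('i \<Rightarrow> 'a) \<Rightarrow> ('i \<Rightarrow> 'a) set" where
  "ultraproduct_map I A U x = ultraproduct_kernel I A U #>\<^bsub>product_group I A\<^esub> x"

lemma normal_ultraproduct_kernel:
  assumes U: "ultrafilter_on I U" and A: "\<And>i. i \<in> I \<Longrightarrow> group (A i)"
  shows "ultraproduct_kernel I A U \<lhd> product_group I A"
proof -
  let ?P = "product_group I A" and ?N = "ultraproduct_kernel I A U"
  interpret P: group ?P using A by simp
  have up: "T \<in> U" if "S \<in> U" "S \<subseteq> T" "T \<subseteq> I" for S T
    using U that unfolding ultrafilter_on_def by blast
  have int: "S \<inter> T \<in> U" if "S \<in> U" "T \<in> U" for S T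
    using U that unfolding ultrafilter_on_def by blast
  have "I \<in> U" using U unfolding ultrafilter_on_def by blast
  have sub: "subgroup ?N ?P"
  proof (rule P.subgroupI)
    show "?N \<subseteq> carrier ?P" unfolding ultraproduct_kernel_def by blast
    have "\<one>\<^bsub>?P\<^esub> \<in> ?N"
      unfolding ultraproduct_kernel_def using \<open>I \<in> U\<close> P.one_closed
      by (auto elim: up[rotated -1])
    then show "?N \<noteq> {}" by blast
  next
    fix x assume x: "x \<in> ?N"
    then have xc: "x \<in> carrier ?P" unfolding ultraproduct_kernel_def by blast
    have "{i \<in> I. x i = \<one>\<^bsub>A i\<^esub>} \<subseteq> {i \<in> I. (inv\<^bsub>?P\<^esub> x) i = \<one>\<^bsub>A i\<^esub>}"
      using xc A by (auto simp: group.is_monoid monoid.inv_one)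
    then show "inv\<^bsub>?P\<^esub> x \<in> ?N"
      using x P.inv_closed[OF xc] up unfolding ultraproduct_kernel_def by blast
  next
    fix x y assume x: "x \<in> ?N" and y: "y \<in> ?N"
    then have xc: "x \<in> carrier ?P" and yc: "y \<in> carrier ?P"
      unfolding ultraproduct_kernel_def by auto
    have "{i \<in> I. x i = \<one>\<^bsub>A i\<^esub>} \<inter> {i \<in> I. y i = \<one>\<^bsub>A i\<^esub>} \<subseteq> {i \<in> I. (x \<otimes>\<^bsub>?P\<^esub> y) i = \<one>\<^bsub>A i\<^esub>}"
      using A by (auto simp: group.is_monoid monoid.l_one monoid.one_closed)
    moreover have "{i \<in> I. x i = \<one>\<^bsub>A i\<^esub>} \<inter> {i \<in> I. y i = \<one>\<^bsub>A i\<^esub>} \<in> U"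
      using x y int unfolding ultraproduct_kernel_def by blast
    ultimately show "x \<otimes>\<^bsub>?P\<^esub> y \<in> ?N"
      using P.m_closed[OF xc yc] up unfolding ultraproduct_kernel_def by blast
  qed
  show ?thesis
  proof (rule P.normal_invI[OF sub])
    fix x h assume x: "x \<in> carrier ?P" and h: "h \<in> ?N"
    then have hc: "h \<in> carrier ?P" unfolding ultraproduct_kernel_def by blast
    have xi: "x i \<in> carrier (A i)" if "i \<in> I" for i using x that by auto
    have "{i \<in> I. h i = \<one>\<^bsub>A i\<^esub>} \<subseteq> {i \<in> I. (x \<otimes>\<^bsub>?P\<^esub> h \<otimes>\<^bsub>?P\<^esub> inv\<^bsub>?P\<^esub> x) i = \<one>\<^bsub>A i\<^esub>}"
      using x A xi by (auto simp: group.is_monoid monoid.r_one group.r_inv)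
    moreover have "x \<otimes>\<^bsub>?P\<^esub> h \<otimes>\<^bsub>?P\<^esub> inv\<^bsub>?P\<^esub> x \<in> carrier ?P"
      using x hc by (meson P.m_closed P.inv_closed)
    ultimately show "x \<otimes>\<^bsub>?P\<^esub> h \<otimes>\<^bsub>?P\<^esub> inv\<^bsub>?P\<^esub> x \<in> ?N"
      using h up unfolding ultraproduct_kernel_def by blast
  qed
qed

lemma ultraproduct_map_eq_iff:
  assumes U: "ultrafilter_on I U" and A: "\<And>i. i \<in> I \<Longrightarrow> group (A i)"
    and x: "x \<in> carrier (product_group I A)" and y: "y \<in> carrier (product_group I A)"
  shows "ultraproduct_map I A U x = ultraproduct_map I A U y \<longleftrightarrow> {i \<in> I. x i = y i} \<in> U"
proof -
  let ?P = "product_group I A" and ?N = "ultraproduct_kernel I A U"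
  interpret P: group ?P using A by simp
  interpret N: normal ?N ?P using U A by (rule normal_ultraproduct_kernel)
  have "ultraproduct_map I A U x = ultraproduct_map I A U y \<longleftrightarrow> x \<in> ?N #>\<^bsub>?P\<^esub> y"
    unfolding ultraproduct_map_def
    using P.repr_independence[OF _ y N.subgroup_axioms] P.rcos_self[OF x N.subgroup_axioms]
    by metis
  also have "\<dots> \<longleftrightarrow> x \<otimes>\<^bsub>?P\<^esub> inv\<^bsub>?P\<^esub> y \<in> ?N"
    using N.rcos_module[OF P.is_group y x] .
  also have "\<dots> \<longleftrightarrow> {i \<in> I. (x \<otimes>\<^bsub>?P\<^esub> inv\<^bsub>?P\<^esub> y) i = \<one>\<^bsub>A i\<^esub>} \<in> U"
    using P.m_closed[OF x P.inv_closed[OF y]] unfolding ultraproduct_kernel_def by blast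
  also have "{i \<in> I. (x \<otimes>\<^bsub>?P\<^esub> inv\<^bsub>?P\<^esub> y) i = \<one>\<^bsub>A i\<^esub>} = {i \<in> I. x i = y i}"
  proof (rule Collect_cong, rule conj_cong[OF refl])
    fix i assume i: "i \<in> I"
    have "x i \<in> carrier (A i)" "y i \<in> carrier (A i)" using x y i by auto
    moreover from this have "x i \<otimes>\<^bsub>A i\<^esub> inv\<^bsub>A i\<^esub> y i = \<one>\<^bsub>A i\<^esub> \<longleftrightarrow> x i = y i"
      using A[OF i] by (metis group.inv_closed group.inv_inv group.inv_equality group.r_inv)
    ultimately show "((x \<otimes>\<^bsub>?P\<^esub> inv\<^bsub>?P\<^esub> y) i = \<one>\<^bsub>A i\<^esub>) = (x i = y i)"
      using i y A by simp
  qed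
  finally show ?thesis .
qed

text \<open>
  Here \<open>C\<close> is the kind of ultrafilter allowed, and the ultrafilters \<open>U 0, \<dots>, U (m - 1)\<close> need
  not be distinct; \<open>m = 0\<close> is allowed.
\<close>

definition factors_through_ultraproducts ::
    "('i set set \<Rightarrow> bool) \<Rightarrow> 'i set \<Rightarrow> ('i \<Rightarrow> 'a monoid) \<Rightarrow> 'b monoid \<Rightarrow> (('i \<Rightarrow> 'a) \<Rightarrow> 'b) \<Rightarrow> bool" where
  "factors_through_ultraproducts C I A B f \<longleftrightarrow>
     (\<exists>(m::nat) (U :: nat \<Rightarrow> 'i set set) g.
        (\<forall>k<m. ultrafilter_on I (U k) \<and> C (U k)) \<and>
        g \<in> hom (product_group {..<m} (\<lambda>k. ultraproduct I A (U k))) B \<and>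
        (\<forall>x \<in> carrier (product_group I A).
           f x = g (\<lambda>k\<in>{..<m}. ultraproduct_map I A (U k) x)))"

abbreviation Z_omega :: "(nat \<Rightarrow> int) monoid" where
  "Z_omega \<equiv> product_group UNIV (\<lambda>_. integer_group)"

definition slender :: "'b monoid \<Rightarrow> bool" where
  "slender B \<longleftrightarrow>
     comm_group B \<and>
     (\<forall>x \<in> carrier B. \<forall>n::nat. 0 < n \<and> x [^]\<^bsub>B\<^esub> n = \<one>\<^bsub>B\<^esub> \<longrightarrow> x = \<one>\<^bsub>B\<^esub>) \<and>
     (\<forall>f \<in> hom Z_omega B. finite {n::nat. f (\<lambda>k. if k = n then 1 else 0) \<noteq> \<one>\<^bsub>B\<^esub>})"

text \<open>
  A family of groups indexed by a set is modelled by \<open>I :: 'i set\<close> and \<open>A :: 'i \<Rightarrow> 'a monoid\<close>, so the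
  index sets and the group elements come from two types that are arbitrary but fixed in any one
  statement. An equivalence involving the existence of such a family with a homomorphism
  onto a given group \<open>B\<close> therefore has to assume that these types are large enough, namely that \<open>'i\<close> is
  infinite and that \<open>carrier B\<close> injects into \<open>'a\<close>.
\<close>

end

theory Submission
  imports Defs
begin

text \<open>
  Let \<open>f\<close> be a homomorphism from a product of abelian groups \<open>A i\<close> to a slender group \<open>B\<close>. Call a set
  \<open>S\<close> of indices negligible if \<open>f\<close> kills every family supported on \<open>S\<close>. Negligible sets form an ideal,
  and slenderness enters through a single principle: if a sequence of families is such that each
  index meets only finitely many of them nontrivially, then \<open>f\<close> kills all but finitely many of them
  (\<open>finite_nontrivial_of_locally_finite\<close>), because all integer combinations of the sequence exist and
  give a homomorphism from \<open>Z_omega\<close>. Applied to the tails of one family it shows that the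
  ideal is countably complete (\<open>negligible_UN\<close>); applied to families with disjoint supports it shows
  that there is no infinite sequence of disjoint sets that are not negligible
  (\<open>disjoint_sequence_negligible\<close>). So the index set is, up to a negligible set, a finite disjoint
  union of atoms of the quotient by the ideal (\<open>decomposable_index_set\<close>). Each atom yields a countably
  complete ultrafilter, a family that is trivial modulo all of these ultrafilters is supported on a
  negligible set, and the natural map to the finitely many ultraproducts is surjective as the
  atoms are disjoint. Hence \<open>f\<close> factors through it (\<open>factors\<close>).

  Conversely, finitely many ultrafilters contain only finitely many singletons between them, so a
  homomorphism that is nontrivial on infinitely many of the factors cannot factor through finitely
  many ultraproducts (\<open>not_factors_if_infinitely_many_coordinates_matter\<close>). If \<open>B\<close> is torsion-free and
  not slender, a homomorphism from \<open>Z_omega\<close> of this kind exists by definition. If \<open>B\<close> has an element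
  of finite order, let \<open>G\<close> be the finite cyclic subgroup that it generates; the sum of finitely many
  elements of \<open>G\<close> extends to infinite sequences as the limit of the partial sums along a
  free ultrafilter (\<open>finite_comm_group_infinite_product_hom\<close>). Surjectivity costs nothing: adjoin \<open>B\<close>
  itself as one more factor, on which the map is the identity.
\<close>

section \<open>Homomorphisms from products to slender groups\<close>

lemma hom_factors_through_epi:
  assumes p: "p \<in> epi G H" and f: "f \<in> hom G K" and G: "group G"
    and pf: "\<And>x y. x \<in> carrier G \<Longrightarrow> y \<in> carrier G \<Longrightarrow> p x = p y \<Longrightarrow> f x = f y"
  obtains g where "g \<in> hom H K" "\<And>x. x \<in> carrier G \<Longrightarrow> f x = g (p x)"
proof -
  interpret G: group G by fact
  have ph: "p \<in> hom G H" and surj: "p ` carrier G = carrier H"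
    using p by (auto simp: epi_def)
  define s where "s = inv_into (carrier G) p"
  have s: "s h \<in> carrier G" "p (s h) = h" if "h \<in> carrier H" for h
    using that unfolding s_def surj[symmetric] by (auto intro: inv_into_into f_inv_into_f)
  show thesis
  proof
    have "f (s (h \<otimes>\<^bsub>H\<^esub> h')) = f (s h) \<otimes>\<^bsub>K\<^esub> f (s h')" if h: "h \<in> carrier H" "h' \<in> carrier H" for h h'
    proof -
      have hh: "h \<otimes>\<^bsub>H\<^esub> h' = p (s h \<otimes>\<^bsub>G\<^esub> s h')"
        using s h hom_mult[OF ph] by metis
      then have "h \<otimes>\<^bsub>H\<^esub> h' \<in> carrier H"
        using hom_in_carrier[OF ph] s h by (metis G.m_closed)
      then have "f (s (h \<otimes>\<^bsub>H\<^esub> h')) = f (s h \<otimes>\<^bsub>G\<^esub> s h')"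
        using s h hh by (intro pf) auto
      then show ?thesis
        using hom_mult[OF f] s h by metis
    qed
    then show "(\<lambda>h. f (s h)) \<in> hom H K"
      using s hom_in_carrier[OF f] by (intro homI) auto
    show "f x = f (s (p x))" if "x \<in> carrier G" for x
      using that s hom_in_carrier[OF ph] by (intro pf) auto
  qed
qed

text \<open>
  At each index only finitely many members of the sequence are nontrivial, so infinite combinations
  with arbitrary integer exponents are finite products coordinatewise.
\<close>

lemma locally_finite_family_extends_to_Z_omega:
  assumes A: "\<And>i. i \<in> I \<Longrightarrow> comm_group (A i)"
    and y: "\<And>n::nat. y n \<in> carrier (product_group I A)"
    and fin: "\<And>i. i \<in> I \<Longrightarrow> finite {n. y n i \<noteq> \<one>\<^bsub>A i\<^esub>}"
  obtains h where "h \<in> hom Z_omega (product_group I A)"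
    "\<And>n. h (\<lambda>k. if k = n then 1 else 0) = y n"
proof -
  define h where "h a = (\<lambda>i\<in>I. finprod (A i) (\<lambda>n. y n i [^]\<^bsub>A i\<^esub> (a n::int)) {n. y n i \<noteq> \<one>\<^bsub>A i\<^esub>})" for a
  have yi: "y n i \<in> carrier (A i)" if "i \<in> I" for n i
    using y[of n] that by auto
  have h_hom: "h \<in> hom Z_omega (product_group I A)"
  proof (rule homI)
    fix a :: "nat \<Rightarrow> int"
    show "h a \<in> carrier (product_group I A)"
    proof -
      have "finprod (A i) (\<lambda>n. y n i [^]\<^bsub>A i\<^esub> a n) {n. y n i \<noteq> \<one>\<^bsub>A i\<^esub>} \<in> carrier (A i)" if i: "i \<in> I" for i
      proof -
        interpret comm_group "A i" using A i .
        show ?thesis using yi i by (intro finprod_closed) auto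
      qed
      then show ?thesis by (auto simp: h_def)
    qed
  next
    fix a b :: "nat \<Rightarrow> int"
    have "finprod (A i) (\<lambda>n. y n i [^]\<^bsub>A i\<^esub> (a n + b n)) {n. y n i \<noteq> \<one>\<^bsub>A i\<^esub>} =
      finprod (A i) (\<lambda>n. y n i [^]\<^bsub>A i\<^esub> a n) {n. y n i \<noteq> \<one>\<^bsub>A i\<^esub>} \<otimes>\<^bsub>A i\<^esub>
      finprod (A i) (\<lambda>n. y n i [^]\<^bsub>A i\<^esub> b n) {n. y n i \<noteq> \<one>\<^bsub>A i\<^esub>}" if i: "i \<in> I" for i
    proof -
      interpret comm_group "A i" using A i .
      show ?thesis
        using yi[OF i] finprod_multf[of "\<lambda>n. y n i [^]\<^bsub>A i\<^esub> a n" "{n. y n i \<noteq> \<one>\<^bsub>A i\<^esub>}" "\<lambda>n. y n i [^]\<^bsub>A i\<^esub> b n"]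
        by (simp add: int_pow_mult)
    qed
    then show "h (a \<otimes>\<^bsub>Z_omega\<^esub> b) = h a \<otimes>\<^bsub>product_group I A\<^esub> h b"
      by (auto simp: h_def fun_eq_iff)
  qed
  have h_delta: "h (\<lambda>k. if k = n then 1 else 0) = y n" for n
  proof
    fix i
    show "h (\<lambda>k. if k = n then 1 else 0) i = y n i"
    proof (cases "i \<in> I")
      case True
      interpret comm_group "A i" using A True .
      let ?N = "{n. y n i \<noteq> \<one>\<^bsub>A i\<^esub>}"
      have "finprod (A i) (\<lambda>k. y k i [^]\<^bsub>A i\<^esub> (if k = n then 1 else 0::int)) ?N
        = finprod (A i) (\<lambda>k. if n = k then y k i else \<one>\<^bsub>A i\<^esub>) ?N"
        using yi[OF True] by (intro finprod_cong') auto
      also have "\<dots> = y n i"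
      proof (cases "n \<in> ?N")
        case n: True
        then show ?thesis
          using yi[OF True] fin[OF True] by (intro finprod_singleton) auto
      next
        case n: False
        then show ?thesis by (auto intro!: finprod_one_eqI)
      qed
      finally show ?thesis using True by (simp add: h_def)
    next
      case False
      then show ?thesis using PiE_arb[OF y[of n, unfolded carrier_product_group]] by (simp add: h_def)
    qed
  qed
  show thesis by (rule that[OF h_hom h_delta])
qed

locale slender_product_hom =
  fixes I :: "'i set" and A :: "'i \<Rightarrow> 'a monoid" and B :: "'b monoid" and f
  assumes factor: "\<And>i. i \<in> I \<Longrightarrow> comm_group (A i)"
    and slender: "slender B"
    and hom: "f \<in> hom (product_group I A) B"
begin

abbreviation "P \<equiv> product_group I A"

definition cutoff where "cutoff S x = (\<lambda>i\<in>I. if i \<in> S then x i else \<one>\<^bsub>A i\<^esub>)"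

definition negligible where "negligible S \<longleftrightarrow> (\<forall>x \<in> carrier P. f (cutoff S x) = \<one>\<^bsub>B\<^esub>)"

lemma group_factor: "i \<in> I \<Longrightarrow> group (A i)"
  using factor comm_group.axioms(2) by blast

sublocale B: comm_group B
  using slender by (simp add: slender_def)

sublocale P: group P
  using group_factor by simp

sublocale f: group_hom P B f
  using hom by unfold_locales

lemma cutoff_closed [simp]: "x \<in> carrier P \<Longrightarrow> cutoff S x \<in> carrier P"
  using group_factor by (auto simp: cutoff_def group.is_monoid)

lemma cutoff_cutoff: "cutoff S (cutoff T x) = cutoff (S \<inter> T) x"
  by (auto simp: cutoff_def)

lemma cutoff_self: "x \<in> carrier P \<Longrightarrow> I \<subseteq> S \<Longrightarrow> cutoff S x = x"
  by (auto simp: cutoff_def fun_eq_iff)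

lemma f_cutoff_Un:
  assumes "x \<in> carrier P" "S \<inter> T = {}"
  shows "f (cutoff (S \<union> T) x) = f (cutoff S x) \<otimes>\<^bsub>B\<^esub> f (cutoff T x)"
proof -
  have "cutoff (S \<union> T) x = cutoff S x \<otimes>\<^bsub>P\<^esub> cutoff T x"
    using assms group_factor
    by (auto simp: cutoff_def fun_eq_iff group.is_monoid Pi_iff PiE_iff)
  then show ?thesis
    using assms(1) f.hom_mult cutoff_closed by metis
qed

lemma negligibleD: "negligible S \<Longrightarrow> x \<in> carrier P \<Longrightarrow> f (cutoff S x) = \<one>\<^bsub>B\<^esub>"
  by (simp add: negligible_def)

lemma negligible_empty [simp]: "negligible {}"
proof -
  have "cutoff {} x = \<one>\<^bsub>P\<^esub>" for x by (simp add: cutoff_def)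
  then show ?thesis using f.hom_one by (simp only: negligible_def) simp
qed

lemma negligible_subset: "negligible T \<Longrightarrow> S \<subseteq> T \<Longrightarrow> negligible S"
  unfolding negligible_def by (metis cutoff_closed cutoff_cutoff inf.absorb2)

lemma f_cutoff_cong:
  assumes x: "x \<in> carrier P" and "S \<subseteq> T" "negligible (T - S)"
  shows "f (cutoff T x) = f (cutoff S x)"
proof -
  have "f (cutoff (S \<union> (T - S)) x) = f (cutoff S x)"
    using assms by (subst f_cutoff_Un) (auto simp: negligibleD simp del: carrier_product_group)
  then show ?thesis
    using assms(2) by (simp add: Un_absorb1)
qed

lemma negligible_Un:
  assumes "negligible S" "negligible T"
  shows "negligible (S \<union> T)"
proof -
  have "negligible (S \<union> T - S)"
    using assms negligible_subset by (metis Diff_subset Un_Diff Diff_cancel sup_bot_left)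
  then show ?thesis
    using assms f_cutoff_cong[of _ S "S \<union> T"] by (auto simp: negligible_def simp del: carrier_product_group)
qed

lemma negligible_Un_iff: "negligible (S \<union> T) \<longleftrightarrow> negligible S \<and> negligible T"
  using negligible_Un negligible_subset by blast

text \<open>
  Composing \<open>f\<close> with a homomorphism that sends the unit vectors of \<open>Z_omega\<close> to the families \<open>y n\<close>
  reduces this to the definition of a slender group.
\<close>

lemma finite_nontrivial_of_locally_finite:
  assumes y: "\<And>n::nat. y n \<in> carrier P"
    and fin: "\<And>i. i \<in> I \<Longrightarrow> finite {n. y n i \<noteq> \<one>\<^bsub>A i\<^esub>}"
  shows "finite {n. f (y n) \<noteq> \<one>\<^bsub>B\<^esub>}"
proof -
  obtain h where h: "h \<in> hom Z_omega P" "\<And>n. h (\<lambda>k. if k = n then 1 else 0) = y n"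
    using locally_finite_family_extends_to_Z_omega[of I A y] factor y fin by blast
  have "(f \<circ> h) \<in> hom Z_omega B"
    using hom_compose[OF h(1) hom] .
  then have "finite {n. (f \<circ> h) (\<lambda>k. if k = n then 1 else 0) \<noteq> \<one>\<^bsub>B\<^esub>}"
    using slender unfolding slender_def by blast
  then show ?thesis by (simp add: h(2))
qed

text \<open>
  Removing finitely many of the sets from the support does not change the value of \<open>f\<close>, so all tails
  \<open>y n\<close> of a family supported on the union have the same value. But the tails are locally finite, hence
  almost all of these equal values are trivial.
\<close>

lemma negligible_UN:
  assumes T: "\<And>n::nat. negligible (T n)"
  shows "negligible (\<Union>n. T n)"
  unfolding negligible_def
proof (intro ballI)
  fix x assume x: "x \<in> carrier P"
  define y where "y n = cutoff ((\<Union>n. T n) - (\<Union>k<n. T k)) x" for n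
  have "negligible (\<Union>k<n. T k)" for n
    using T by (induction n) (auto simp: lessThan_Suc negligible_Un)
  then have tail: "f (y n) = f (cutoff (\<Union>n. T n) x)" for n
    unfolding y_def using x by (intro f_cutoff_cong[symmetric]) (auto intro: negligible_subset simp del: carrier_product_group)
  have "finite {n. y n i \<noteq> \<one>\<^bsub>A i\<^esub>}" if i: "i \<in> I" for i
  proof (cases "i \<in> (\<Union>n. T n)")
    case True
    then obtain k where "i \<in> T k" by blast
    then have "{n. y n i \<noteq> \<one>\<^bsub>A i\<^esub>} \<subseteq> {..k}"
      using i by (auto simp: y_def cutoff_def not_le)
    then show ?thesis using finite_subset by blast
  next
    case False
    then show ?thesis using i by (auto simp: y_def cutoff_def)
  qed
  then have "finite {n. f (y n) \<noteq> \<one>\<^bsub>B\<^esub>}"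
    using x by (intro finite_nontrivial_of_locally_finite) (auto simp: y_def simp del: carrier_product_group)
  then show "f (cutoff (\<Union>n. T n) x) = \<one>\<^bsub>B\<^esub>"
    unfolding tail by (cases "f (cutoff (\<Union>n. T n) x) = \<one>\<^bsub>B\<^esub>") auto
qed

text \<open>Families with disjoint supports are locally finite.\<close>

lemma disjoint_sequence_negligible:
  assumes R: "disjoint_family (R :: nat \<Rightarrow> _)"
  shows "\<exists>n. negligible (R n)"
proof (rule ccontr)
  assume "\<nexists>n. negligible (R n)"
  then have "\<exists>x. x \<in> carrier P \<and> f (cutoff (R n) x) \<noteq> \<one>\<^bsub>B\<^esub>" for n
    by (auto simp: negligible_def simp del: carrier_product_group)
  then have "\<exists>x. \<forall>n. x n \<in> carrier P \<and> f (cutoff (R n) (x n)) \<noteq> \<one>\<^bsub>B\<^esub>"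
    by (intro choice allI)
  then obtain x
    where x: "\<And>n. x n \<in> carrier P" "\<And>n. f (cutoff (R n) (x n)) \<noteq> \<one>\<^bsub>B\<^esub>"
    by (elim exE) (rule that; blast)
  have "finite {n. cutoff (R n) (x n) i \<noteq> \<one>\<^bsub>A i\<^esub>}" if i: "i \<in> I" for i
  proof (cases "\<exists>k. i \<in> R k")
    case True
    then obtain k where k: "i \<in> R k" by blast
    then have "{n. cutoff (R n) (x n) i \<noteq> \<one>\<^bsub>A i\<^esub>} \<subseteq> {k}"
      using R i by (auto simp: cutoff_def disjoint_family_on_def)
    then show ?thesis using finite_subset by blast
  next
    case False
    then show ?thesis using i by (auto simp: cutoff_def)
  qed
  then have "finite {n. f (cutoff (R n) (x n)) \<noteq> \<one>\<^bsub>B\<^esub>}"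
    using x by (intro finite_nontrivial_of_locally_finite) (auto simp del: carrier_product_group)
  then show False using x(2) by simp
qed

text \<open>An atom of the Boolean algebra of subsets of \<open>I\<close> modulo negligible sets.\<close>

definition atom where
  "atom S \<longleftrightarrow> S \<subseteq> I \<and> \<not> negligible S \<and> (\<forall>T. T \<subseteq> S \<longrightarrow> negligible T \<or> negligible (S - T))"

definition decomposable where
  "decomposable S \<longleftrightarrow> (\<exists>F. finite F \<and> disjoint F \<and> (\<forall>T\<in>F. atom T \<and> T \<subseteq> S) \<and> negligible (S - \<Union>F))"

lemma decomposable_Un:
  assumes "decomposable S" "decomposable T" "S \<inter> T = {}"
  shows "decomposable (S \<union> T)"
proof -
  obtain F where F: "finite F" "disjoint F" "\<And>Q. Q \<in> F \<Longrightarrow> atom Q \<and> Q \<subseteq> S" "negligible (S - \<Union>F)"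
    using assms(1) unfolding decomposable_def by blast
  obtain G where G: "finite G" "disjoint G" "\<And>Q. Q \<in> G \<Longrightarrow> atom Q \<and> Q \<subseteq> T" "negligible (T - \<Union>G)"
    using assms(2) unfolding decomposable_def by blast
  have "disjoint (F \<union> G)"
    using F(2,3) G(2,3) assms(3) by (intro disjoint_union) blast+
  moreover have "negligible (S \<union> T - \<Union>(F \<union> G))"
    by (rule negligible_subset[OF negligible_Un[OF F(4) G(4)]]) blast
  ultimately show ?thesis
    unfolding decomposable_def using F(1,3) G(1,3)
    by (intro exI[of _ "F \<union> G"]) blast
qed

lemma decomposable_atom: "atom S \<Longrightarrow> decomposable S"
  unfolding decomposable_def by (intro exI[of _ "{S}"]) (auto simp: disjoint_def)

lemma decomposable_negligible: "negligible S \<Longrightarrow> decomposable S"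
  unfolding decomposable_def by (intro exI[of _ "{}"]) (auto simp: disjoint_def)

text \<open>
  A set that is not decomposable is neither negligible nor an atom, so it splits into two sets that
  are not negligible, and one of these is again not decomposable. Repeating this forever
  leaves behind an infinite disjoint sequence of sets that are not negligible.
\<close>

lemma decomposable_index_set: "decomposable I"
proof (rule ccontr)
  assume I: "\<not> decomposable I"
  have split: "\<exists>T. (T \<subseteq> I \<and> \<not> decomposable T) \<and> T \<subseteq> S \<and> \<not> negligible (S - T)"
    if S: "S \<subseteq> I \<and> \<not> decomposable S" for S
  proof -
    obtain T where T: "T \<subseteq> S" "\<not> negligible T" "\<not> negligible (S - T)"
      using S decomposable_atom decomposable_negligible unfolding atom_def by blast
    have "\<not> decomposable T \<or> \<not> decomposable (S - T)"
      using S T(1) decomposable_Un[of T "S - T"] by (auto simp: Un_absorb1)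
    moreover have "S - (S - T) = T" using T(1) by blast
    ultimately show ?thesis
      using S T by (metis Diff_subset order_trans)
  qed
  have "\<exists>S. \<forall>n::nat. (S n \<subseteq> I \<and> \<not> decomposable (S n)) \<and>
      (S (Suc n) \<subseteq> S n \<and> \<not> negligible (S n - S (Suc n)))"
  proof (rule dependent_nat_choice)
    show "\<exists>S. S \<subseteq> I \<and> \<not> decomposable S" using I by blast
  qed (rule split)
  then obtain S where S: "\<And>n::nat. S (Suc n) \<subseteq> S n" "\<And>n. \<not> negligible (S n - S (Suc n))"
    by auto
  have "decseq S" using S(1) by (simp add: decseq_Suc_iff)
  have "disjoint_family (\<lambda>n. S n - S (Suc n))"
  proof -
    have "(S m - S (Suc m)) \<inter> (S n - S (Suc n)) = {}" if "m < n" for m n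
      using decseqD[OF \<open>decseq S\<close>, of "Suc m" n] that by auto
    then show ?thesis
      unfolding disjoint_family_on_def by (metis Int_commute nat_neq_iff)
  qed
  then show False
    using disjoint_sequence_negligible S(2) by blast
qed

definition atom_ultrafilter where "atom_ultrafilter S = {T. T \<subseteq> I \<and> negligible (S - T)}"

lemma ultrafilter_atom_ultrafilter:
  assumes "atom S" shows "ultrafilter_on I (atom_ultrafilter S)"
proof -
  have S: "S \<subseteq> I" "\<not> negligible S" "\<And>T. T \<subseteq> S \<Longrightarrow> negligible T \<or> negligible (S - T)"
    using assms unfolding atom_def by auto
  have 1: "T \<in> atom_ultrafilter S \<or> I - T \<in> atom_ultrafilter S" if "T \<subseteq> I" for T
  proof -
    have "S - (I - T) = S \<inter> T" "S - S \<inter> T = S - T" using S(1) by blast+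
    then show ?thesis
      using S(3)[of "S \<inter> T"] that by (auto simp: atom_ultrafilter_def)
  qed
  have 2: "T \<inter> T' \<in> atom_ultrafilter S" if "T \<in> atom_ultrafilter S" "T' \<in> atom_ultrafilter S" for T T'
    using that unfolding atom_ultrafilter_def by (auto simp: Diff_Int negligible_Un)
  have 3: "T' \<in> atom_ultrafilter S" if "T \<in> atom_ultrafilter S" "T \<subseteq> T' \<and> T' \<subseteq> I" for T T'
    using that unfolding atom_ultrafilter_def by (auto elim!: negligible_subset)
  have 4: "I \<in> atom_ultrafilter S" "{} \<notin> atom_ultrafilter S" "atom_ultrafilter S \<subseteq> Pow I"
    using S(1,2) unfolding atom_ultrafilter_def by (auto simp: Diff_eq_empty_iff[THEN iffD2])
  show ?thesis
    unfolding ultrafilter_on_def using 1 2 3 4 by blast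
qed

lemma countably_complete_atom_ultrafilter: "countably_complete (atom_ultrafilter S)"
  unfolding countably_complete_def
proof (intro allI impI)
  fix T :: "nat \<Rightarrow> _" assume "\<forall>n. T n \<in> atom_ultrafilter S"
  then have "\<And>n. negligible (S - T n)" "\<And>n. T n \<subseteq> I"
    by (auto simp: atom_ultrafilter_def)
  moreover have "S - (\<Inter>n. T n) = (\<Union>n. S - T n)" by blast
  ultimately show "(\<Inter>n. T n) \<in> atom_ultrafilter S"
    using negligible_UN[of "\<lambda>n. S - T n"] by (auto simp: atom_ultrafilter_def INF_lower2)
qed

text \<open>
  The map \<open>p\<close> below is the natural map to the ultraproducts at the atoms \<open>s k\<close>. It suffices that \<open>p\<close> is
  surjective and that \<open>f x\<close> is determined by \<open>p x\<close>.
\<close>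

lemma factors: "factors_through_ultraproducts countably_complete I A B f"
proof -
  obtain F where F: "finite F" "disjoint F" "\<And>S. S \<in> F \<Longrightarrow> atom S" "negligible (I - \<Union>F)"
    using decomposable_index_set unfolding decomposable_def by blast
  obtain s where s: "bij_betw s {..<card F} F"
    using ex_bij_betw_nat_finite[OF F(1)] by (auto simp: atLeast0LessThan)
  define m where "m = card F"
  define U where "U k = atom_ultrafilter (s k)" for k
  have atom_s: "atom (s k)" if "k < m" for k
    using that F(3) s unfolding m_def by (auto simp: bij_betw_def)
  have disj: "s k \<inter> s l = {}" if "k < m" "l < m" "k \<noteq> l" for k l
  proof -
    have "s k \<in> F" "s l \<in> F" "s k \<noteq> s l"
      using that s unfolding m_def bij_betw_def inj_on_def by auto
    then show ?thesis using F(2) unfolding disjoint_def by blast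
  qed
  have U: "ultrafilter_on I (U k)" if "k < m" for k
    unfolding U_def using ultrafilter_atom_ultrafilter atom_s that by blast
  let ?H = "product_group {..<m} (\<lambda>k. ultraproduct I A (U k))"
  define p where "p x = (\<lambda>k\<in>{..<m}. ultraproduct_map I A (U k) x)" for x
  have N: "normal (ultraproduct_kernel I A (U k)) P" if "k < m" for k
    using normal_ultraproduct_kernel U that group_factor by blast
  have q_hom: "ultraproduct_map I A (U k) \<in> hom P (ultraproduct I A (U k))" if "k < m" for k
    unfolding ultraproduct_map_def ultraproduct_def
    using normal.r_coset_hom_Mod[OF N[OF that]] .
  have eqI: "ultraproduct_map I A (U k) x = ultraproduct_map I A (U k) y \<longleftrightarrow>
      negligible (s k - {i \<in> I. x i = y i})"
    if "k < m" "x \<in> carrier P" "y \<in> carrier P" for k x y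
    using ultraproduct_map_eq_iff[OF U[OF that(1)] group_factor that(2,3)]
    by (auto simp: U_def atom_ultrafilter_def)
  have p_hom: "p \<in> hom P ?H"
  proof (rule homI)
    fix x assume "x \<in> carrier P"
    then show "p x \<in> carrier ?H"
      using hom_in_carrier[OF q_hom] by (auto simp: p_def)
  next
    fix x y assume "x \<in> carrier P" "y \<in> carrier P"
    then have "p (x \<otimes>\<^bsub>P\<^esub> y) k = (p x \<otimes>\<^bsub>?H\<^esub> p y) k" for k
      using hom_mult[OF q_hom[of k]] by (auto simp: p_def simp del: mult_product_group carrier_product_group) (simp add: p_def)+
    then show "p (x \<otimes>\<^bsub>P\<^esub> y) = p x \<otimes>\<^bsub>?H\<^esub> p y" by blast
  qed
  have p_surj: "carrier ?H \<subseteq> p ` carrier P"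
  proof
    fix c assume c: "c \<in> carrier ?H"
    have "\<exists>x\<in>carrier P. ultraproduct_map I A (U k) x = c k" if "k < m" for k
    proof -
      have "c k \<in> carrier (ultraproduct I A (U k))" using c that by auto
      then show ?thesis
        unfolding ultraproduct_def ultraproduct_map_def FactGroup_def RCOSETS_def by auto
    qed
    then obtain x where x: "\<And>k. k < m \<Longrightarrow> x k \<in> carrier P"
        "\<And>k. k < m \<Longrightarrow> ultraproduct_map I A (U k) (x k) = c k"
      by metis
    \<comment> \<open>Representatives can be glued because the atoms are pairwise disjoint.\<close>
    define z where "z = (\<lambda>i\<in>I. if \<exists>k<m. i \<in> s k then x (THE k. k < m \<and> i \<in> s k) i else \<one>\<^bsub>A i\<^esub>)"
    have z: "z i = x k i" if "i \<in> s k" "k < m" for i k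
    proof -
      have "(THE k. k < m \<and> i \<in> s k) = k"
        using that disj by (intro the_equality) blast+
      moreover have "i \<in> I" using atom_s that unfolding atom_def by blast
      ultimately show ?thesis using that by (auto simp: z_def)
    qed
    have "z i \<in> carrier (A i)" if i: "i \<in> I" for i
    proof (cases "\<exists>k<m. i \<in> s k")
      case True
      then obtain k where "k < m" "i \<in> s k" by blast
      then show ?thesis using z x(1)[of k] i by auto
    next
      case False
      then show ?thesis using i group_factor[OF i] by (auto simp: z_def group.is_monoid)
    qed
    then have zP: "z \<in> carrier P" by (auto simp: z_def)
    have "ultraproduct_map I A (U k) z = c k" if k: "k < m" for k
    proof -
      have "s k - {i \<in> I. z i = x k i} = {}"
        using z k atom_s[OF k] unfolding atom_def by blast
      then show ?thesis
        using x(2)[OF k] eqI[OF k zP x(1)[OF k]] negligible_empty by metis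
    qed
    then have "p z = c"
      using PiE_arb[OF c[unfolded carrier_product_group]] by (auto simp: p_def fun_eq_iff)
    then show "c \<in> p ` carrier P" using zP by blast
  qed
  have p: "p \<in> epi P ?H"
    unfolding epi_def using p_hom p_surj hom_in_carrier[OF p_hom] by blast
  have pf: "f x = f y" if x: "x \<in> carrier P" and y: "y \<in> carrier P" and eq: "p x = p y" for x y
  proof -
    let ?E = "{i \<in> I. x i = y i}"
    have "negligible (s k - ?E)" if "k < m" for k
      using eqI[OF that x y] fun_cong[OF eq, of k] that by (simp add: p_def)
    then have "negligible (\<Union>k<j. s k - ?E)" if "j \<le> m" for j
      using that by (induction j) (auto simp: lessThan_Suc negligible_Un_iff)
    then have "negligible ((\<Union>k<m. s k - ?E) \<union> (I - \<Union>F))"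
      using F(4) by (simp add: negligible_Un)
    moreover have "I - ?E \<subseteq> (\<Union>k<m. s k - ?E) \<union> (I - \<Union>F)"
      using s unfolding m_def bij_betw_def by blast
    ultimately have "negligible (I - ?E)" by (rule negligible_subset)
    then have "f (cutoff I z) = f (cutoff ?E z)" if "z \<in> carrier P" for z
      using that by (intro f_cutoff_cong) auto
    moreover have "cutoff ?E x = cutoff ?E y" by (auto simp: cutoff_def fun_eq_iff)
    ultimately show ?thesis using x y by (metis cutoff_self order_refl)
  qed
  obtain g where g: "g \<in> hom ?H B" "\<And>x. x \<in> carrier P \<Longrightarrow> f x = g (p x)"
    using hom_factors_through_epi[OF p hom P.group_axioms pf] by blast
  have "\<forall>k<m. ultrafilter_on I (U k) \<and> countably_complete (U k)"
    using U countably_complete_atom_ultrafilter by (simp add: U_def)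
  with g show ?thesis
    unfolding factors_through_ultraproducts_def p_def
    by (intro exI[of _ m] exI[of _ U] exI[of _ g] conjI ballI)
qed

end

section \<open>Homomorphisms that do not factor\<close>

text \<open>
  An ultrafilter contains at most one singleton. At an index \<open>i\<close> whose singleton is in none of the given
  ultrafilters, a family supported on \<open>{i}\<close> is trivial in every ultraproduct.
\<close>

lemma not_factors_if_infinitely_many_coordinates_matter:
  assumes A: "\<And>i. i \<in> I \<Longrightarrow> group (A i)" and B: "group B" and f: "f \<in> hom (product_group I A) B"
    and inf: "infinite {i \<in> I. \<exists>x \<in> carrier (product_group I A).
      (\<forall>j \<in> I - {i}. x j = \<one>\<^bsub>A j\<^esub>) \<and> f x \<noteq> \<one>\<^bsub>B\<^esub>}"
  shows "\<not> factors_through_ultraproducts C I A B f"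
proof
  let ?P = "product_group I A"
  assume "factors_through_ultraproducts C I A B f"
  then obtain m U g where U: "\<And>k. k < (m::nat) \<Longrightarrow> ultrafilter_on I (U k)"
    and g: "\<And>x. x \<in> carrier ?P \<Longrightarrow> f x = g (\<lambda>k\<in>{..<m}. ultraproduct_map I A (U k) x)"
    unfolding factors_through_ultraproducts_def by blast
  have "\<exists>j. \<forall>i\<in>I. {i} \<in> U k \<longrightarrow> i = j" if "k < m" for k
  proof (cases "\<exists>j. {j} \<in> U k")
    case True
    then obtain j where j: "{j} \<in> U k" by blast
    have "i = j" if "{i} \<in> U k" for i
    proof (rule ccontr)
      assume "i \<noteq> j"
      then have "{i} \<inter> {j} = {}" by blast
      then show False
        using U[OF \<open>k < m\<close>] j that unfolding ultrafilter_on_def by metis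
    qed
    then show ?thesis by blast
  qed blast
  then obtain j where j: "\<And>k i. k < m \<Longrightarrow> i \<in> I \<Longrightarrow> {i} \<in> U k \<Longrightarrow> i = j k"
    by metis
  obtain i where i: "i \<in> I" "i \<notin> j ` {..<m}"
    and "\<exists>x \<in> carrier ?P. (\<forall>j \<in> I - {i}. x j = \<one>\<^bsub>A j\<^esub>) \<and> f x \<noteq> \<one>\<^bsub>B\<^esub>"
    using infinite_super[OF _ inf, of "j ` {..<m}"] by blast
  then obtain x where x: "x \<in> carrier ?P" "\<And>j. j \<in> I \<Longrightarrow> j \<noteq> i \<Longrightarrow> x j = \<one>\<^bsub>A j\<^esub>" "f x \<noteq> \<one>\<^bsub>B\<^esub>"
    by blast
  interpret P: group ?P using A by simp
  have "ultraproduct_map I A (U k) x = ultraproduct_map I A (U k) \<one>\<^bsub>?P\<^esub>" if k: "k < m" for k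
  proof -
    have "I - {i} \<in> U k"
      using U[OF k] j[OF k i(1)] i k unfolding ultrafilter_on_def by blast
    moreover have "I - {i} \<subseteq> {j \<in> I. x j = \<one>\<^bsub>?P\<^esub> j}" using x(2) by auto
    ultimately have "{j \<in> I. x j = \<one>\<^bsub>?P\<^esub> j} \<in> U k"
      using U[OF k] unfolding ultrafilter_on_def by blast
    then show ?thesis
      using ultraproduct_map_eq_iff[OF U[OF k] A x(1) P.one_closed] by blast
  qed
  then have "(\<lambda>k\<in>{..<m}. ultraproduct_map I A (U k) x) = (\<lambda>k\<in>{..<m}. ultraproduct_map I A (U k) \<one>\<^bsub>?P\<^esub>)"
    by (intro restrict_ext) blast
  then have "f x = f \<one>\<^bsub>?P\<^esub>"
    using g[OF x(1)] g[OF P.one_closed] by (simp only:)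
  also have "\<dots> = \<one>\<^bsub>B\<^esub>"
    using hom_one[OF f P.group_axioms B] .
  finally show False using x(3) by contradiction
qed

lemma comm_group_copy:
  assumes G: "comm_group G" and le: "carrier G \<lesssim> (UNIV :: 'a set)"
  obtains G' :: "'a monoid" and d where "comm_group G'" "d \<in> iso G' G"
proof -
  interpret G: comm_group G by fact
  obtain h :: "_ \<Rightarrow> 'a" where h: "inj_on h (carrier G)"
    using le unfolding lepoll_def by blast
  have iso: "h \<in> iso G (image_group h G)" using inj_imp_image_group_iso[OF h] .
  interpret G': group "image_group h G" using G.inj_imp_image_group_is_group[OF h] .
  show thesis
    using that[of "image_group h G"] G.iso_imp_comm_group[OF is_isoI[OF iso] G'.is_monoid]
      G.iso_set_sym[OF iso] by blast
qed

text \<open>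
  The first index \<open>e 0\<close> carries a copy of \<open>B\<close> that makes the map surjective, and the other
  indices carry copies of \<open>G\<close> on which the map is \<open>F\<close>.
\<close>

lemma epi_not_factoring_through_ultraproducts:
  fixes e :: "nat \<Rightarrow> 'i" and B :: "'b monoid" and G :: "'c monoid"
  assumes e: "inj e" and B: "comm_group B" "carrier B \<lesssim> (UNIV :: 'a set)"
    and G: "comm_group G" "carrier G \<lesssim> (UNIV :: 'a set)"
    and F: "F \<in> hom (product_group UNIV (\<lambda>_::nat. G)) B"
    and inf: "infinite {n. \<exists>x \<in> carrier G. F (\<lambda>k. if k = n then x else \<one>\<^bsub>G\<^esub>) \<noteq> \<one>\<^bsub>B\<^esub>}"
  shows "\<exists>(A :: 'i \<Rightarrow> 'a monoid) f. (\<forall>i \<in> range e. comm_group (A i)) \<and>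
    f \<in> epi (product_group (range e) A) B \<and> \<not> factors_through_ultraproducts C (range e) A B f"
proof -
  interpret B: comm_group B by fact
  interpret G: comm_group G by fact
  obtain B' :: "'a monoid" and b where B': "comm_group B'" "b \<in> iso B' B"
    using comm_group_copy[OF B] .
  obtain G' :: "'a monoid" and c where G': "comm_group G'" "c \<in> iso G' G"
    using comm_group_copy[OF G] .
  interpret B': comm_group B' by fact
  interpret G': comm_group G' by fact
  have b: "b \<in> hom B' B" "b ` carrier B' = carrier B" and c: "c \<in> hom G' G" "c ` carrier G' = carrier G"
    using B'(2) G'(2) by (auto simp: iso_def bij_betw_def)
  have b_one: "b \<one>\<^bsub>B'\<^esub> = \<one>\<^bsub>B\<^esub>" using hom_one[OF b(1)] by simp
  have c_one: "c \<one>\<^bsub>G'\<^esub> = \<one>\<^bsub>G\<^esub>" using hom_one[OF c(1)] by simp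
  have e_iff: "e m = e n \<longleftrightarrow> m = n" for m n using e by (auto dest: injD)
  define A where "A i = (if i = e 0 then B' else G')" for i
  have A: "comm_group (A i)" for i using B'(1) G'(1) by (simp add: A_def)
  let ?P = "product_group (range e) A"
  have xe: "x (e n) \<in> carrier (A (e n))" if "x \<in> carrier ?P" for x n
    using that by auto
  have x0: "x (e 0) \<in> carrier B'" and xS: "x (e (Suc n)) \<in> carrier G'" if "x \<in> carrier ?P" for x n
    using xe[OF that, of 0] xe[OF that, of "Suc n"] by (simp_all add: A_def e_iff)
  define t where "t x = (\<lambda>n. c (x (e (Suc n))))" for x
  define f where "f x = b (x (e 0)) \<otimes>\<^bsub>B\<^esub> F (t x)" for x
  let ?Q = "product_group UNIV (\<lambda>_::nat. G)"
  interpret Q: group ?Q by simp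
  have t: "t x \<in> carrier ?Q" if "x \<in> carrier ?P" for x
    using hom_in_carrier[OF c(1) xS[OF that]] by (auto simp: t_def)
  have F_one: "F (\<lambda>_. \<one>\<^bsub>G\<^esub>) = \<one>\<^bsub>B\<^esub>"
    using hom_one[OF F Q.group_axioms B.group_axioms] by (simp add: restrict_def)
  have f_hom: "f \<in> hom ?P B"
  proof (rule homI)
    fix x assume x: "x \<in> carrier ?P"
    show "f x \<in> carrier B"
      unfolding f_def using hom_in_carrier[OF b(1) x0[OF x]] hom_in_carrier[OF F t[OF x]] by simp
  next
    fix x y assume x: "x \<in> carrier ?P" and y: "y \<in> carrier ?P"
    have xy: "(x \<otimes>\<^bsub>?P\<^esub> y) (e n) = x (e n) \<otimes>\<^bsub>A (e n)\<^esub> y (e n)" for n by simp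
    have "t (x \<otimes>\<^bsub>?P\<^esub> y) = t x \<otimes>\<^bsub>?Q\<^esub> t y"
      using hom_mult[OF c(1) xS[OF x] xS[OF y]] unfolding t_def xy
      by (auto simp: A_def e_iff fun_eq_iff)
    moreover have "b ((x \<otimes>\<^bsub>?P\<^esub> y) (e 0)) = b (x (e 0)) \<otimes>\<^bsub>B\<^esub> b (y (e 0))"
      using hom_mult[OF b(1) x0[OF x] x0[OF y]] unfolding xy by (simp add: A_def)
    ultimately show "f (x \<otimes>\<^bsub>?P\<^esub> y) = f x \<otimes>\<^bsub>B\<^esub> f y"
      unfolding f_def hom_mult[OF F t[OF x] t[OF y], symmetric]
      using hom_mult[OF F t[OF x] t[OF y]] hom_in_carrier[OF b(1) x0[OF x]] hom_in_carrier[OF F t[OF x]]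
        hom_in_carrier[OF b(1) x0[OF y]] hom_in_carrier[OF F t[OF y]]
      by (simp only: B.m_ac B.m_closed)
  qed
  have "carrier B \<subseteq> f ` carrier ?P"
  proof
    fix z assume "z \<in> carrier B"
    then obtain w where w: "w \<in> carrier B'" "b w = z" unfolding b(2)[symmetric] by (elim imageE) simp
    define x where "x = (\<lambda>i\<in>range e. if i = e 0 then w else \<one>\<^bsub>G'\<^esub>)"
    have "x \<in> carrier ?P" using w by (auto simp: x_def A_def)
    moreover have "f x = z"
      using w F_one \<open>z \<in> carrier B\<close> by (simp add: f_def t_def x_def e_iff c_one)
    ultimately show "z \<in> f ` carrier ?P" by blast
  qed
  then have f_epi: "f \<in> epi ?P B"
    unfolding epi_def using f_hom hom_in_carrier[OF f_hom] by blast
  let ?N = "{n. \<exists>x \<in> carrier G. F (\<lambda>k. if k = n then x else \<one>\<^bsub>G\<^esub>) \<noteq> \<one>\<^bsub>B\<^esub>}"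
  have "e (Suc n) \<in> {i \<in> range e. \<exists>x \<in> carrier ?P. (\<forall>j \<in> range e - {i}. x j = \<one>\<^bsub>A j\<^esub>) \<and> f x \<noteq> \<one>\<^bsub>B\<^esub>}"
    if "n \<in> ?N" for n
  proof -
    obtain y where y: "y \<in> carrier G" "F (\<lambda>k. if k = n then y else \<one>\<^bsub>G\<^esub>) \<noteq> \<one>\<^bsub>B\<^esub>"
      using \<open>n \<in> ?N\<close> by blast
    obtain w where w: "w \<in> carrier G'" "c w = y" using y(1) unfolding c(2)[symmetric] by (elim imageE) simp
    define x where "x = (\<lambda>i\<in>range e. if i = e (Suc n) then w else \<one>\<^bsub>A i\<^esub>)"
    have xP: "x \<in> carrier ?P" using w A by (auto simp: x_def A_def e_iff)
    have "t x = (\<lambda>k. if k = n then y else \<one>\<^bsub>G\<^esub>)"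
      using w by (auto simp: t_def x_def A_def e_iff c_one)
    moreover have "x (e 0) = \<one>\<^bsub>B'\<^esub>" by (simp add: x_def A_def e_iff)
    ultimately have "f x = F (\<lambda>k. if k = n then y else \<one>\<^bsub>G\<^esub>)"
      using hom_in_carrier[OF F t[OF xP]] by (simp add: f_def b_one)
    then have "f x \<noteq> \<one>\<^bsub>B\<^esub>" using y(2) by simp
    moreover have "\<forall>j \<in> range e - {e (Suc n)}. x j = \<one>\<^bsub>A j\<^esub>" by (simp add: x_def)
    ultimately show ?thesis using xP by blast
  qed
  then have "(\<lambda>n. e (Suc n)) ` ?N \<subseteq>
      {i \<in> range e. \<exists>x \<in> carrier ?P. (\<forall>j \<in> range e - {i}. x j = \<one>\<^bsub>A j\<^esub>) \<and> f x \<noteq> \<one>\<^bsub>B\<^esub>}"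
    by blast
  moreover have "infinite ((\<lambda>n. e (Suc n)) ` ?N)"
    using inf finite_imageD[of "\<lambda>n. e (Suc n)" ?N] by (auto simp: inj_on_def e_iff)
  ultimately have "\<not> factors_through_ultraproducts C (range e) A B f"
    using A B.group_axioms f_hom
    by (intro not_factors_if_infinitely_many_coordinates_matter)
      (auto simp: comm_group.axioms(2) dest: finite_subset)
  then show ?thesis using A f_epi by blast
qed

section \<open>Summation along a free ultrafilter\<close>

text \<open>
  A maximal family all of whose finite intersections are infinite is an ultrafilter: if neither \<open>S\<close> nor
  its complement could be added, two finite subfamilies would witness this, and their union would
  have a finite intersection.
\<close>

lemma free_ultrafilter_exists:
  assumes I: "infinite I"
  obtains U where "ultrafilter_on I U" "\<And>S. S \<in> U \<Longrightarrow> infinite S"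
proof -
  define \<A> where "\<A> = {F. F \<subseteq> Pow I \<and> (\<forall>T. finite T \<longrightarrow> T \<subseteq> F \<longrightarrow> infinite (I \<inter> \<Inter>T))}"
  have "\<exists>M\<in>\<A>. \<forall>F\<in>\<A>. M \<subseteq> F \<longrightarrow> F = M"
  proof (rule subset_Zorn_nonempty)
    show "\<A> \<noteq> {}" using I by (auto simp: \<A>_def intro!: exI[of _ "{}"])
  next
    fix \<C> assume ne: "\<C> \<noteq> {}" and ch: "subset.chain \<A> \<C>"
    have sub: "\<C> \<subseteq> \<A>" using ch by (simp add: subset_chain_def)
    have "infinite (I \<inter> \<Inter>T)" if T: "finite T" "T \<subseteq> \<Union>\<C>" for T
    proof -
      obtain F where "F \<in> \<C>" "T \<subseteq> F"
        using finite_subset_Union_chain[OF T ne ch] by blast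
      then show ?thesis using sub T(1) by (auto simp: \<A>_def)
    qed
    then show "\<Union>\<C> \<in> \<A>" using sub by (auto simp: \<A>_def)
  qed
  then obtain M where M: "M \<in> \<A>" and max: "\<And>F. F \<in> \<A> \<Longrightarrow> M \<subseteq> F \<Longrightarrow> F = M" by blast
  have fip: "infinite (I \<inter> \<Inter>T)" if "finite T" "T \<subseteq> M" for T
    using M that by (auto simp: \<A>_def)
  have subI: "M \<subseteq> Pow I" using M by (auto simp: \<A>_def)
  have memI: "S \<in> M" if S: "S \<subseteq> I" and ST: "\<And>T. finite T \<Longrightarrow> T \<subseteq> M \<Longrightarrow> infinite (I \<inter> \<Inter>T \<inter> S)" for S
  proof -
    have "infinite (I \<inter> \<Inter>T)" if T: "finite T" "T \<subseteq> insert S M" for T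
    proof -
      have "infinite (I \<inter> \<Inter>(T - {S}) \<inter> S)" using T by (intro ST) auto
      moreover have "I \<inter> \<Inter>(T - {S}) \<inter> S \<subseteq> I \<inter> \<Inter>T" by blast
      ultimately show ?thesis using infinite_super by blast
    qed
    then have "insert S M \<in> \<A>" using S subI by (auto simp: \<A>_def)
    then show ?thesis using max[of "insert S M"] by blast
  qed
  have inf: "infinite S" if "S \<in> M" for S
    using fip[of "{S}"] that by auto
  have up: "T \<in> M" if "S \<in> M" "S \<subseteq> T" "T \<subseteq> I" for S T
  proof (rule memI)
    fix R assume R: "finite R" "R \<subseteq> M"
    have "infinite (I \<inter> \<Inter>(insert S R))" using R that by (intro fip) auto
    moreover have "I \<inter> \<Inter>(insert S R) \<subseteq> I \<inter> \<Inter>R \<inter> T" using that by auto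
    ultimately show "infinite (I \<inter> \<Inter>R \<inter> T)" using infinite_super by blast
  qed fact
  have int: "S \<inter> T \<in> M" if "S \<in> M" "T \<in> M" for S T
  proof (rule memI)
    show "S \<inter> T \<subseteq> I" using that subI by blast
    fix R assume R: "finite R" "R \<subseteq> M"
    have "infinite (I \<inter> \<Inter>(insert S (insert T R)))" using R that by (intro fip) auto
    moreover have "I \<inter> \<Inter>(insert S (insert T R)) = I \<inter> \<Inter>R \<inter> (S \<inter> T)" by auto
    ultimately show "infinite (I \<inter> \<Inter>R \<inter> (S \<inter> T))" by simp
  qed
  have dich: "S \<in> M \<or> I - S \<in> M" if S: "S \<subseteq> I" for S
  proof (rule ccontr)
    assume *: "\<not> ?thesis"
    obtain R where R: "finite R" "R \<subseteq> M" "finite (I \<inter> \<Inter>R \<inter> S)"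
      using * memI[OF S] by blast
    obtain R' where R': "finite R'" "R' \<subseteq> M" "finite (I \<inter> \<Inter>R' \<inter> (I - S))"
      using * memI[of "I - S"] by blast
    have "I \<inter> \<Inter>(R \<union> R') \<subseteq> (I \<inter> \<Inter>R \<inter> S) \<union> (I \<inter> \<Inter>R' \<inter> (I - S))" by blast
    then have "finite (I \<inter> \<Inter>(R \<union> R'))" using R(3) R'(3) finite_subset by blast
    then show False using fip[of "R \<union> R'"] R R' by blast
  qed
  have "I \<in> M" using fip by (intro memI) (auto simp: Int_absorb2 Int_commute Int_left_commute)
  moreover have "{} \<notin> M" using inf by blast
  ultimately have "ultrafilter_on I M"
    unfolding ultrafilter_on_def using subI int up dich by blast
  then show thesis using inf that by blast
qed

lemma
  assumes "ultrafilter_on I U"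
  shows ultrafilter_Int: "S \<in> U \<Longrightarrow> T \<in> U \<Longrightarrow> S \<inter> T \<in> U"
    and ultrafilter_superset: "S \<in> U \<Longrightarrow> S \<subseteq> T \<Longrightarrow> T \<subseteq> I \<Longrightarrow> T \<in> U"
    and ultrafilter_complement: "S \<subseteq> I \<Longrightarrow> S \<notin> U \<Longrightarrow> I - S \<in> U"
  using assms unfolding ultrafilter_on_def by blast+

lemma ultrafilter_finite_partition:
  assumes U: "ultrafilter_on I U" and "finite C" "{i \<in> I. g i \<in> C} \<in> U"
  shows "\<exists>c\<in>C. {i \<in> I. g i = c} \<in> U"
  using assms(2,3)
proof (induction C rule: finite_induct)
  case empty
  then show ?case using U by (simp add: ultrafilter_on_def)
next
  case (insert c C)
  show ?case
  proof (cases "{i \<in> I. g i = c} \<in> U")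
    case False
    then have "I - {i \<in> I. g i = c} \<in> U"
      by (intro ultrafilter_complement[OF U]) auto
    from ultrafilter_Int[OF U this insert.prems] have "{i \<in> I. g i \<in> C} \<in> U"
      by (rule ultrafilter_superset[OF U]) auto
    then show ?thesis using insert.IH by blast
  qed blast
qed

text \<open>
  The sequence of partial products takes finitely many values, so exactly one of them is taken on
  a set in the ultrafilter. A sequence with one nontrivial entry has eventually constant partial
  products, and cofinite sets belong to every free ultrafilter.
\<close>

lemma finite_comm_group_infinite_product_hom:
  assumes G: "comm_group G" and fin: "finite (carrier G)"
  obtains F where "F \<in> hom (product_group (UNIV :: nat set) (\<lambda>_. G)) G"
    "\<And>n x. x \<in> carrier G \<Longrightarrow> F (\<lambda>k. if k = n then x else \<one>\<^bsub>G\<^esub>) = x"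
proof -
  interpret comm_group G by fact
  let ?P = "product_group (UNIV :: nat set) (\<lambda>_. G)"
  obtain U :: "nat set set" where U: "ultrafilter_on UNIV U" and inf: "\<And>S. S \<in> U \<Longrightarrow> infinite S"
    using free_ultrafilter_exists[OF infinite_UNIV_nat] by blast
  have up: "T \<in> U" if "S \<in> U" "S \<subseteq> T" for S T
    using U that unfolding ultrafilter_on_def by blast
  have int: "S \<inter> T \<in> U" if "S \<in> U" "T \<in> U" for S T
    using U that unfolding ultrafilter_on_def by blast
  define s where "s a n = finprod G a {..<n}" for a and n :: nat
  have s: "s a n \<in> carrier G" if "a \<in> carrier ?P" for a and n :: nat
    using that unfolding s_def by (intro finprod_closed) auto
  define F where "F a = (THE b. {n. s a n = b} \<in> U)" for a
  have F_eq: "F a = b" if "{n. s a n = b} \<in> U" for a b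
    unfolding F_def
  proof (rule the_equality)
    fix b' assume "{n. s a n = b'} \<in> U"
    then have "infinite ({n. s a n = b'} \<inter> {n. s a n = b})" using int that inf by blast
    then obtain n where "s a n = b'" "s a n = b" using infinite_imp_nonempty by blast
    then show "b' = b" by simp
  qed fact
  have F: "F a \<in> carrier G \<and> {n. s a n = F a} \<in> U" if a: "a \<in> carrier ?P" for a
  proof -
    have "UNIV \<in> U" using U unfolding ultrafilter_on_def by blast
    then have "\<exists>b\<in>carrier G. {n \<in> UNIV. s a n = b} \<in> U"
      using s[OF a] by (intro ultrafilter_finite_partition[OF U fin]) simp
    then show ?thesis using F_eq by auto
  qed
  have "F \<in> hom ?P G"
  proof (rule homI)
    fix a b assume a: "a \<in> carrier ?P" and b: "b \<in> carrier ?P"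
    have "s (a \<otimes>\<^bsub>?P\<^esub> b) n = s a n \<otimes>\<^bsub>G\<^esub> s b n" for n
      unfolding s_def using a b by (simp add: finprod_multf Pi_iff PiE_iff restrict_def)
    then have "{n. s a n = F a} \<inter> {n. s b n = F b} \<subseteq> {n. s (a \<otimes>\<^bsub>?P\<^esub> b) n = F a \<otimes>\<^bsub>G\<^esub> F b}" by auto
    then show "F (a \<otimes>\<^bsub>?P\<^esub> b) = F a \<otimes>\<^bsub>G\<^esub> F b"
      using F[OF a] F[OF b] by (intro F_eq) (blast intro: int up)
  qed (use F in blast)
  moreover have "F (\<lambda>k. if k = n then x else \<one>\<^bsub>G\<^esub>) = x" if x: "x \<in> carrier G" for n x
  proof (rule F_eq)
    have "s (\<lambda>k. if k = n then x else \<one>\<^bsub>G\<^esub>) m = x" if "n < m" for m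
    proof -
      have "finprod G (\<lambda>k. if n = k then x else \<one>\<^bsub>G\<^esub>) {..<m} = x"
        using that x by (intro finprod_singleton) auto
      then show ?thesis unfolding s_def by (simp only: eq_commute[of n])
    qed
    then have "- {..n} \<subseteq> {m. s (\<lambda>k. if k = n then x else \<one>\<^bsub>G\<^esub>) m = x}" by auto
    moreover have "- {..n} \<in> U"
      using U inf[of "{..n}"] unfolding ultrafilter_on_def by (auto simp: Compl_eq_Diff_UNIV)
    ultimately show "{m. s (\<lambda>k. if k = n then x else \<one>\<^bsub>G\<^esub>) m = x} \<in> U" by (rule up[rotated])
  qed
  ultimately show thesis by (rule that)
qed

section \<open>The characterization of slender groups\<close>

text \<open>
  In either case all factors but \<open>B\<close> itself are cyclic subgroups of \<open>B\<close> up to isomorphism, so they fit into any type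
  that accommodates \<open>B\<close>; for the integers this needs an element of infinite order in \<open>B\<close>.
\<close>

lemma not_slender_imp_epi_not_factoring:
  fixes e :: "nat \<Rightarrow> 'i" and B :: "'b monoid"
  assumes e: "inj e" and B: "comm_group B" "carrier B \<lesssim> (UNIV :: 'a set)" and ns: "\<not> slender B"
  shows "\<exists>(A :: 'i \<Rightarrow> 'a monoid) f. (\<forall>i \<in> range e. comm_group (A i)) \<and>
    f \<in> epi (product_group (range e) A) B \<and> \<not> factors_through_ultraproducts C (range e) A B f"
proof -
  interpret B: comm_group B by fact
  show ?thesis
  proof (cases "\<exists>x\<in>carrier B. \<exists>n::nat. 0 < n \<and> x [^]\<^bsub>B\<^esub> n = \<one>\<^bsub>B\<^esub> \<and> x \<noteq> \<one>\<^bsub>B\<^esub>")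
    case True
    then obtain x n where x: "x \<in> carrier B" "0 < (n::nat)" "x [^]\<^bsub>B\<^esub> n = \<one>\<^bsub>B\<^esub>" "x \<noteq> \<one>\<^bsub>B\<^esub>" by blast
    define H where "H = range (\<lambda>k::int. x [^]\<^bsub>B\<^esub> k)"
    interpret pow: group_hom integer_group B "\<lambda>k. x [^]\<^bsub>B\<^esub> k"
      using B.hom_integer_group_pow[OF x(1)] B.group_axioms
      by (simp add: group_hom_def group_hom_axioms_def)
    have sub: "subgroup H B" using pow.img_is_subgroup by (simp add: H_def)
    have HB: "H \<subseteq> carrier B" using subgroup.subset[OF sub] .
    let ?G = "B\<lparr>carrier := H\<rparr>"
    have G: "comm_group ?G"
      using B.subgroup_imp_group[OF sub] HB B.m_comm by (intro group.group_comm_groupI) auto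
    have "x [^]\<^bsub>B\<^esub> k = x [^]\<^bsub>B\<^esub> (k mod int n)" for k :: int
    proof -
      have "B.ord x dvd n" using x B.pow_eq_id by blast
      then have "int (B.ord x) dvd k mod int n - k"
        by (metis dvd_diff_commute dvd_minus_mod dvd_trans int_dvd_int_iff)
      then show ?thesis using B.int_pow_eq[OF x(1)] by blast
    qed
    moreover have "k mod int n \<in> {0..<int n}" for k using x(2) by simp
    ultimately have "H \<subseteq> (\<lambda>k. x [^]\<^bsub>B\<^esub> k) ` {0..<int n}" unfolding H_def by blast
    then have "finite (carrier ?G)" using finite_surj[of "{0..<int n}"] by simp
    from finite_comm_group_infinite_product_hom[OF G this]
    obtain F where F: "F \<in> hom (product_group (UNIV :: nat set) (\<lambda>_. ?G)) ?G"
      "\<And>n x. x \<in> carrier ?G \<Longrightarrow> F (\<lambda>k. if k = n then x else \<one>\<^bsub>?G\<^esub>) = x" by blast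
    have FB: "F \<in> hom (product_group (UNIV :: nat set) (\<lambda>_. ?G)) B"
      using F(1) HB by (auto simp: hom_def)
    have "carrier ?G \<lesssim> (UNIV :: 'a set)"
      using lepoll_trans[OF subset_imp_lepoll[OF HB] B(2)] by simp
    moreover have "x \<in> carrier ?G"
      using rangeI[of "\<lambda>k::int. x [^]\<^bsub>B\<^esub> k" 1] x(1) by (simp add: H_def)
    then have "\<exists>x \<in> carrier ?G. F (\<lambda>k. if k = n then x else \<one>\<^bsub>?G\<^esub>) \<noteq> \<one>\<^bsub>B\<^esub>" for n
      using F(2) x(4) by metis
    then have "infinite {n. \<exists>x \<in> carrier ?G. F (\<lambda>k. if k = n then x else \<one>\<^bsub>?G\<^esub>) \<noteq> \<one>\<^bsub>B\<^esub>}" by simp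
    ultimately show ?thesis
      by (intro epi_not_factoring_through_ultraproducts[OF e B G _ FB])
  next
    case False
    then obtain f where f: "f \<in> hom Z_omega B"
      and inf: "infinite {n::nat. f (\<lambda>k. if k = n then 1 else 0) \<noteq> \<one>\<^bsub>B\<^esub>}"
      using ns B(1) unfolding slender_def by blast
    obtain n where n: "f (\<lambda>k. if k = n then 1 else 0) \<noteq> \<one>\<^bsub>B\<^esub>"
      using infinite_imp_nonempty[OF inf] by blast
    define y where "y = f (\<lambda>k. if k = n then 1 else 0)"
    have y: "y \<in> carrier B" unfolding y_def by (rule hom_in_carrier[OF f]) simp
    have "B.ord y = 0"
      using False n y B.ord_eq_0[OF y] unfolding y_def by blast
    then have "inj (\<lambda>k::int. y [^]\<^bsub>B\<^esub> k) \<and> range (\<lambda>k::int. y [^]\<^bsub>B\<^esub> k) \<subseteq> carrier B"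
      using B.int_pow_eq[OF y] B.int_pow_closed[OF y] by (auto simp: inj_on_def)
    then have "(UNIV :: int set) \<lesssim> carrier B"
      unfolding lepoll_def by (rule exI[where x = "\<lambda>k::int. y [^]\<^bsub>B\<^esub> k"])
    \<comment> \<open>The type constraint matters: \<open>integer_group\<close> has a polymorphic carrier.\<close>
    moreover define Z where "Z = (integer_group :: int monoid)"
    ultimately have "carrier Z \<lesssim> (UNIV :: 'a set)"
      using lepoll_trans[OF _ B(2)] by simp
    moreover have "{n. f (\<lambda>k. if k = n then 1 else 0) \<noteq> \<one>\<^bsub>B\<^esub>} \<subseteq>
        {n. \<exists>x \<in> carrier Z. f (\<lambda>k. if k = n then x else \<one>\<^bsub>Z\<^esub>) \<noteq> \<one>\<^bsub>B\<^esub>}"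
      unfolding Z_def one_integer_group carrier_integer_group by blast
    then have "infinite {n. \<exists>x \<in> carrier Z. f (\<lambda>k. if k = n then x else \<one>\<^bsub>Z\<^esub>) \<noteq> \<one>\<^bsub>B\<^esub>}"
      using inf by (rule infinite_super)
    moreover have "comm_group Z" "f \<in> hom (product_group UNIV (\<lambda>_. Z)) B"
      using abelian_integer_group f by (simp_all add: Z_def)
    ultimately show ?thesis
      by (intro epi_not_factoring_through_ultraproducts[OF e B])
  qed
qed

theorem proposition21:
  fixes B :: "'b monoid"
  assumes "comm_group B"
    and "infinite (UNIV :: 'i set)"
    and "carrier B \<lesssim> (UNIV :: 'a set)"
  shows
    "((\<exists>(I :: 'i set) (A :: 'i \<Rightarrow> 'a monoid) f.
         (\<forall>i\<in>I. comm_group (A i)) \<and> f \<in> epi (product_group I A) B \<and>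
         \<not> factors_through_ultraproducts countably_complete I A B f)
       \<longleftrightarrow> \<not> slender B) \<and>
     ((\<exists>(A :: nat \<Rightarrow> 'a monoid) f.
         (\<forall>n. comm_group (A n)) \<and> f \<in> epi (product_group UNIV A) B \<and>
         \<not> factors_through_ultraproducts (\<lambda>_. True) UNIV A B f)
       \<longleftrightarrow> \<not> slender B) \<and>
     ((\<exists>(I :: 'i set) (A :: 'i \<Rightarrow> 'a monoid) f.
         (\<forall>i\<in>I. comm_group (A i)) \<and> f \<in> hom (product_group I A) B \<and>
         \<not> factors_through_ultraproducts countably_complete I A B f)
       \<longleftrightarrow> \<not> slender B) \<and>
     ((\<exists>(A :: nat \<Rightarrow> 'a monoid) f.
         (\<forall>n. comm_group (A n)) \<and> f \<in> hom (product_group UNIV A) B \<and>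
         \<not> factors_through_ultraproducts (\<lambda>_. True) UNIV A B f)
       \<longleftrightarrow> \<not> slender B)"
    (is "(?epiI \<longleftrightarrow> _) \<and> (?epiN \<longleftrightarrow> _) \<and> (?homI \<longleftrightarrow> _) \<and> (?homN \<longleftrightarrow> _)")
proof -
  obtain e :: "nat \<Rightarrow> 'i" where e: "inj e"
    using infinite_countable_subset[OF assms(2)] by blast
  have epiI: ?epiI if "\<not> slender B"
    using not_slender_imp_epi_not_factoring[OF e assms(1,3) that] by blast
  have epiN: ?epiN if "\<not> slender B"
    using not_slender_imp_epi_not_factoring[OF inj_on_id assms(1,3) that, of "\<lambda>_. True"] by simp
  have homI: "\<not> slender B" if ?homI
  proof
    assume B: "slender B"
    obtain I and A :: "'i \<Rightarrow> 'a monoid" and f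
      where A: "\<forall>i\<in>I. comm_group (A i)" and f: "f \<in> hom (product_group I A) B"
        and nf: "\<not> factors_through_ultraproducts countably_complete I A B f"
      using \<open>?homI\<close> by blast
    interpret slender_product_hom I A B f
      by (rule slender_product_hom.intro) (use A B f in blast)+
    show False using factors nf by contradiction
  qed
  have homN: "\<not> slender B" if ?homN
  proof
    assume B: "slender B"
    obtain A :: "nat \<Rightarrow> 'a monoid" and f
      where A: "\<And>n. comm_group (A n)" and f: "f \<in> hom (product_group UNIV A) B"
        and nf: "\<not> factors_through_ultraproducts (\<lambda>_. True) UNIV A B f"
      using \<open>?homN\<close> by blast
    interpret slender_product_hom UNIV A B f
      by (rule slender_product_hom.intro) (use A B f in blast)+
    show False
      using factors nf unfolding factors_through_ultraproducts_def by blast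
  qed
  have "?epiI \<Longrightarrow> ?homI" "?epiN \<Longrightarrow> ?homN"
    unfolding epi_def by blast+
  then show ?thesis using epiI epiN homI homN by argo
qed

end
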